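(* Let $\lambda_1,\lambda_2$ be cardinals with $\lambda_2\geqslant\lambda_1\geqslant 1$. Let $B^0_{\lambda_1}(S)$ and $B^0_{\lambda_2}(T)$ be the Brandt $\lambda_1^0$- and $\lambda_2^0$-extensions of monoids $S$ and $T$ with zero, with zeros $0_1$ and $0_2$ respectively. Let $h\colon S\to T$ be a homomorphism such that $h(0_S)=0_T$, and suppose that $\varphi\colon I_{\lambda_1}\to I_{\lambda_2}$ is a one-to-one map. Let $e$ be a non-zero idempotent of $T$, $H_e$ a maximal subgroup of $T$ with the unity $e$, and $u\colon I_{\lambda_1}\to H_e$ a map. Then $I_h=\{s\in S: h(s)=0_T\}$ is an ideal of $S$, and the map $\sigma\colon B^0_{\lambda_1}(S)\to B^0_{\lambda_2}(T)$ defined by $$\sigma(\alpha,s,\beta)=\begin{cases}\bigl(\varphi(\alpha),\,u(\alpha)\cdot h(s)\cdot u(\beta)^{-1},\,\varphi(\beta)\bigr), & \text{if } s\in S\setminus I_h,\\ 0_2, & \text{if } s\in I_h\setminus\{0_S\},\end{cases}$$ and $\sigma(0_1)=0_2$ is a non-trivial homomorphism from $B^0_{\lambda_1}(S)$ into $B^0_{\lambda_2}(T)$ (here $u(\beta)^{-1}$ is the inverse in $H_e$). Moreover, if for the semigroup $T$ the following assertions hold: (i) every idempotent of $T$ lies in the center of $T$; and (ii) $T$ has the $\mathcal{B}^*_{\lambda_1}$-property, then every non-trivial homomorphism from $B^0_{\lambda_1}(S)$ into $B^0_{\lambda_2}(T)$ can be constructed in this manner.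
   Context: $I_\lambda$ denotes a set of cardinality $\lambda\geqslant 1$. For a monoid $S$ with zero $0_S$, the Brandt $\lambda^0$-extension $B^0_\lambda(S)$ is the quotient of the semigroup $(I_\lambda\times S\times I_\lambda)\cup\{0\}$, with multiplication $(\alpha,a,\beta)(\gamma,b,\delta)=(\alpha,ab,\delta)$ if $\beta=\gamma$ and all other products equal to $0$, by the ideal $\{0\}\cup\{(\alpha,0_S,\beta):\alpha,\beta\in I_\lambda\}$; thus all triples $(\alpha,0_S,\beta)$ are identified with the zero $0$, and the non-zero elements are the triples $(\alpha,s,\beta)$ with $s\neq 0_S$. The semigroup $B_\lambda$ of $I_\lambda\times I_\lambda$-matrix units is $B^0_\lambda(\{1,0\})$, where $\{1,0\}$ is the two-element monoid with zero. A semigroup $T$ with zero has the $\mathcal{B}^*_\lambda$-property if (1) $T$ does not contain the semigroup $B_\lambda$ of $I_\lambda\times I_\lambda$-matrix units; and (2) $T$ does not contain the semigroup $B_2$ of $2\times 2$-matrix units such that the zero of $B_2$ is the zero of $T$. A homomorphism is a semigroup homomorphism (not required to preserve identities); it is trivial if it is a constant map, and non-trivial otherwise.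
   Formalization: The claim that σ is a non-trivial homomorphism is proved under the added hypotheses that e commutes with every h(s) and e·h(1_S) ≠ 0 (both hold if h(1_S) = e); without them it fails, e.g. for h = 0. In the converse the data are shown to satisfy these conditions too. *)

theory Defs
  imports
    "HOL-Algebra.Group"
    "HOL-Library.Equipollence"
    "HOL-Library.Numeral_Type"
    "HOL-Library.Z2"
begin

section \<open>Semigroups\<close>

definition semigroup_hom :: "('a::semigroup_mult \<Rightarrow> 'b::semigroup_mult) \<Rightarrow> bool" where
  "semigroup_hom f \<longleftrightarrow> (\<forall>x y. f (x * y) = f x * f y)"

definition trivial_map :: "('a \<Rightarrow> 'b) \<Rightarrow> bool" where
  "trivial_map f \<longleftrightarrow> (\<exists>c. \<forall>x. f x = c)"

definition semigroup_ideal :: "'a::semigroup_mult set \<Rightarrow> bool" where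
  "semigroup_ideal J \<longleftrightarrow> J \<noteq> {} \<and> (\<forall>x\<in>J. \<forall>y. x * y \<in> J \<and> y * x \<in> J)"

definition rees_cong :: "'a::semigroup_mult set \<Rightarrow> 'a \<Rightarrow> 'a \<Rightarrow> bool" where
  "rees_cong J x y \<longleftrightarrow> x = y \<or> x \<in> J \<and> y \<in> J"

abbreviation restricted :: "'a::semigroup_mult set \<Rightarrow> 'a \<Rightarrow> 'a monoid" where
  "restricted G e \<equiv> \<lparr>carrier = G, mult = (*), one = e\<rparr>"

text \<open>The unity of a subgroup of a monoid need not be the unity of the monoid.\<close>

definition maximal_subgroup :: "'a::semigroup_mult set \<Rightarrow> 'a \<Rightarrow> bool" where
  "maximal_subgroup H e \<longleftrightarrow>
     group (restricted H e) \<and> (\<forall>G f. group (restricted G f) \<longrightarrow> H \<subseteq> G \<longrightarrow> G = H)"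


section \<open>Brandt extensions\<close>

text \<open>
  The index set of cardinality \<open>\<lambda> \<ge> 1\<close> is the universe of the type \<open>'i\<close>, and a monoid with zero is
  a type of sort \<open>{monoid_mult, mult_zero}\<close>; \<open>0 = 1\<close> is not excluded.
\<close>

datatype ('i, 's) pre_brandt = Pre_Zero | Pre_Triple 'i 's 'i

instantiation pre_brandt :: (type, semigroup_mult) semigroup_mult
begin

fun times_pre_brandt ::
  "('a, 'b) pre_brandt \<Rightarrow> ('a, 'b) pre_brandt \<Rightarrow> ('a, 'b) pre_brandt" where
  "times_pre_brandt (Pre_Triple \<alpha> a \<beta>) (Pre_Triple \<gamma> b \<delta>) =
     (if \<beta> = \<gamma> then Pre_Triple \<alpha> (a * b) \<delta> else Pre_Zero)"
| "times_pre_brandt Pre_Zero y = Pre_Zero"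
| "times_pre_brandt x Pre_Zero = Pre_Zero"

instance
proof
  fix a b c :: "('a, 'b) pre_brandt"
  show "a * b * c = a * (b * c)"
    by (cases a; cases b; cases c) (auto simp: mult.assoc)
qed

end

definition null_ideal :: "('i, 's::{monoid_mult, mult_zero}) pre_brandt set" where
  "null_ideal = {Pre_Zero} \<union> {Pre_Triple \<alpha> 0 \<beta> | \<alpha> \<beta>. True}"

lemma semigroup_ideal_null_ideal: "semigroup_ideal null_ideal"
proof -
  have "x * y \<in> null_ideal \<and> y * x \<in> null_ideal" if "x \<in> null_ideal"
    for x y :: "('i, 's::{monoid_mult, mult_zero}) pre_brandt"
    using that by (cases x; cases y) (auto simp: null_ideal_def)
  then show ?thesis
    by (auto simp: semigroup_ideal_def null_ideal_def)
qed

lemma rees_cong_mult: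
  assumes "semigroup_ideal J" "rees_cong J x x'" "rees_cong J y y'"
  shows "rees_cong J (x * y) (x' * y')"
  using assms unfolding semigroup_ideal_def rees_cong_def by metis

quotient_type (overloaded) ('i, 's) brandt =
  "('i, 's::{monoid_mult, mult_zero}) pre_brandt" / "rees_cong null_ideal"
  by (rule equivpI) (auto simp: reflp_def symp_def transp_def rees_cong_def)

instantiation brandt :: (type, "{monoid_mult, mult_zero}") "{semigroup_mult, mult_zero}"
begin

lift_definition zero_brandt :: "('a, 'b) brandt" is Pre_Zero .

lift_definition times_brandt :: "('a, 'b) brandt \<Rightarrow> ('a, 'b) brandt \<Rightarrow> ('a, 'b) brandt"
  is "(*)"
  by (rule rees_cong_mult[OF semigroup_ideal_null_ideal])

instance
proof
  fix a b c :: "('a, 'b) brandt"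
  show "a * b * c = a * (b * c)"
    by transfer (simp add: mult.assoc rees_cong_def)
  show "0 * a = 0"
    by transfer (simp add: rees_cong_def)
  show "a * 0 = 0"
  proof transfer
    fix x :: "('a, 'b) pre_brandt"
    show "rees_cong null_ideal (x * Pre_Zero) Pre_Zero"
      by (cases x) (simp_all add: rees_cong_def)
  qed
qed

end

lift_definition triple :: "'i \<Rightarrow> 's \<Rightarrow> 'i \<Rightarrow> ('i, 's::{monoid_mult, mult_zero}) brandt"
  is Pre_Triple .

lemma triple_eq_zero_iff: "triple \<alpha> s \<beta> = 0 \<longleftrightarrow> s = 0"
  by transfer (auto simp: rees_cong_def null_ideal_def)

lemma triple_eq_iff:
  "triple \<alpha> s \<beta> = triple \<gamma> t \<delta> \<longleftrightarrow> s = 0 \<and> t = 0 \<or> \<alpha> = \<gamma> \<and> s = t \<and> \<beta> = \<delta>"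
  by transfer (auto simp: rees_cong_def null_ideal_def)

lemma triple_mult: "triple \<alpha> a \<beta> * triple \<gamma> b \<delta> = (if \<beta> = \<gamma> then triple \<alpha> (a * b) \<delta> else 0)"
  by transfer (simp add: rees_cong_def)

lemma brandt_cases:
  obtains (zero) "x = 0" | (triple) \<alpha> s \<beta> where "x = triple \<alpha> s \<beta>" "s \<noteq> 0"
proof -
  have "x = 0 \<or> (\<exists>\<alpha> s \<beta>. x = triple \<alpha> s \<beta>)"
  proof transfer
    fix y :: "('a, 'b) pre_brandt"
    show "rees_cong null_ideal y Pre_Zero \<or>
        (\<exists>\<alpha> s \<beta>. rees_cong null_ideal y (Pre_Triple \<alpha> s \<beta>))"
      by (cases y) (auto simp: rees_cong_def)
  qed
  then show thesis
    using that triple_eq_zero_iff by metis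
qed

text \<open>
  The type \<open>bit\<close> with its multiplication is the two-element monoid with zero \<open>{1, 0}\<close>. A semigroup
  contains another one if it has a subsemigroup isomorphic to it.
\<close>

type_synonym 'i matrix_units = "('i, bit) brandt"

definition B_star :: "'i itself \<Rightarrow> 't::{semigroup_mult, mult_zero} itself \<Rightarrow> bool" where
  "B_star _ _ \<longleftrightarrow>
     \<not> (\<exists>f :: 'i matrix_units \<Rightarrow> 't. inj f \<and> semigroup_hom f) \<and>
     \<not> (\<exists>f :: 2 matrix_units \<Rightarrow> 't. inj f \<and> semigroup_hom f \<and> f 0 = 0)"


section \<open>The homomorphisms between Brandt extensions\<close>

text \<open>
  The data \<open>map_data\<close> alone do not make the map \<open>\<sigma> = brandt_map h \<phi> e H u\<close> a non-trivial homomorphism: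
  \<^item> For \<open>h = (\<lambda>_. 0)\<close> the map \<open>\<sigma>\<close> is constant.
  \<^item> For \<open>S = T\<close> the monoid of 2 by 2 matrices over a field, \<open>h = id\<close>, \<open>e\<close> the diagonal matrix unit \<open>E11\<close>
    and \<open>u = (\<lambda>_. e)\<close>, one has \<open>\<sigma> (triple \<alpha> s \<alpha>) = triple (\<phi> \<alpha>) (e * s * e) (\<phi> \<alpha>)\<close>, and
    \<open>s \<mapsto> e * s * e\<close> is not multiplicative.
  The link between \<open>e\<close> and \<open>h\<close> that is missing is that \<open>e\<close> commutes with every \<open>h s\<close> and that
  \<open>e * h 1 \<noteq> 0\<close>. Both hold if \<open>h 1 = e\<close>. If the idempotents of \<open>T\<close> are central, the first holds
  automatically, and \<open>\<sigma>\<close> is constant when the second fails.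
\<close>

definition map_data ::
  "('s::{monoid_mult, mult_zero} \<Rightarrow> 't::{monoid_mult, mult_zero}) \<Rightarrow> ('i \<Rightarrow> 'j) \<Rightarrow>
     't \<Rightarrow> 't set \<Rightarrow> ('i \<Rightarrow> 't) \<Rightarrow> bool" where
  "map_data h \<phi> e H u \<longleftrightarrow>
     semigroup_hom h \<and> h 0 = 0 \<and> inj \<phi> \<and>
     e \<noteq> 0 \<and> e * e = e \<and> maximal_subgroup H e \<and> (\<forall>\<alpha>. u \<alpha> \<in> H)"

text \<open>
  The test \<open>s = 0\<close> only serves to make the function well defined on the quotient for every \<open>h\<close>; it is
  subsumed by \<open>h s = 0\<close> when \<open>h 0 = 0\<close>. See the equations \<open>brandt_map_simps\<close> below.
\<close>

lift_definition brandt_map ::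
  "('s::{monoid_mult, mult_zero} \<Rightarrow> 't::{monoid_mult, mult_zero}) \<Rightarrow> ('i \<Rightarrow> 'j) \<Rightarrow>
     't \<Rightarrow> 't set \<Rightarrow> ('i \<Rightarrow> 't) \<Rightarrow> ('i, 's) brandt \<Rightarrow> ('j, 't) brandt"
  is "\<lambda>h \<phi> e H u x. case x of
        Pre_Zero \<Rightarrow> Pre_Zero
      | Pre_Triple \<alpha> s \<beta> \<Rightarrow>
          if s = 0 \<or> h s = 0 then Pre_Zero
          else Pre_Triple (\<phi> \<alpha>) (u \<alpha> * h s * inv\<^bsub>restricted H e\<^esub> (u \<beta>)) (\<phi> \<beta>)"
  by (auto simp: rees_cong_def null_ideal_def split: pre_brandt.splits)

lemma brandt_map_simps:
  assumes "h 0 = 0"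
  shows "h s \<noteq> 0 \<Longrightarrow> brandt_map h \<phi> e H u (triple \<alpha> s \<beta>) =
      triple (\<phi> \<alpha>) (u \<alpha> * h s * inv\<^bsub>restricted H e\<^esub> (u \<beta>)) (\<phi> \<beta>)"
    and "h s = 0 \<Longrightarrow> brandt_map h \<phi> e H u (triple \<alpha> s \<beta>) = 0"
    and "brandt_map h \<phi> e H u 0 = 0"
  using assms by (transfer; auto simp: rees_cong_def)+

end

theory Submission
  imports Defs
begin

text \<open>
  For the converse, let \<open>\<sigma>\<close> be a non-trivial homomorphism. If \<open>\<sigma> 0 \<noteq> 0\<close>, then all values of \<open>\<sigma>\<close> lie
  in one diagonal block, a copy of \<open>T\<close>, and the images of the matrix units form a copy of \<open>B\<^sub>\<lambda>\<close> in \<open>T\<close>;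
  so \<open>\<sigma> 0 = 0\<close>. Then \<open>\<sigma>\<close> maps \<open>(\<alpha>, 1, \<beta>)\<close> to some \<open>(\<phi> \<alpha>, w \<alpha> \<beta>, \<phi> \<beta>)\<close>, and the idempotents
  \<open>w \<alpha> \<alpha> = w \<alpha> \<beta> * w \<beta> \<alpha>\<close> are pairwise \<open>\<D>\<close>-equivalent. As they are central, they all equal one \<open>e\<close>.
  Now fix an index \<open>\<iota>\<close>, put \<open>u \<alpha> = w \<alpha> \<iota>\<close>, and let \<open>h s\<close> be the entry of \<open>\<sigma> (\<iota>, s, \<iota>)\<close>.
\<close>

section \<open>Maximal subgroups\<close>

text \<open>For idempotent \<open>e\<close>, this is the group of units of the local monoid
  \<open>e * T * e\<close>, that is, the Green H-class of \<open>e\<close>.\<close>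

definition unit_group :: "'a::semigroup_mult \<Rightarrow> 'a set" where
  "unit_group e = {x. e * x = x \<and> x * e = x \<and>
     (\<exists>y. e * y = y \<and> y * e = y \<and> x * y = e \<and> y * x = e)}"

lemma unit_groupI:
  assumes "e * x = x" "x * e = x" "e * y = y" "y * e = y" "x * y = e" "y * x = e"
  shows "x \<in> unit_group e"
  using assms unfolding unit_group_def by blast

lemma group_unit_group:
  fixes e :: "'a::semigroup_mult"
  assumes e: "e * e = e"
  shows "group (restricted (unit_group e) e)"
proof (rule groupI; simp)
  fix x y assume x: "x \<in> unit_group e" and y: "y \<in> unit_group e"
  from x obtain x' where x': "e * x = x" "x * e = x" "e * x' = x'" "x' * e = x'"
    "x * x' = e" "x' * x = e"
    unfolding unit_group_def by blast
  from y obtain y' where y': "e * y = y" "y * e = y" "e * y' = y'" "y' * e = y'"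
    "y * y' = e" "y' * y = e"
    unfolding unit_group_def by blast
  show "x * y \<in> unit_group e"
    by (rule unit_groupI[where y = "y' * x'"]) (metis x' y' mult.assoc)+
next
  show "e \<in> unit_group e"
    using e by (auto intro: unit_groupI)
next
  fix x y z :: 'a
  show "x * y * z = x * (y * z)"
    by (rule mult.assoc)
next
  fix x assume "x \<in> unit_group e"
  then show "e * x = x"
    unfolding unit_group_def by blast
next
  fix x assume "x \<in> unit_group e"
  then show "\<exists>y\<in>unit_group e. y * x = e"
    unfolding unit_group_def by blast
qed

lemma group_subset_unit_group:
  assumes "group (restricted G e)"
  shows "G \<subseteq> unit_group e"
proof
  interpret group "restricted G e" by fact
  fix x assume x: "x \<in> G"
  have y: "inv\<^bsub>restricted G e\<^esub> x \<in> G"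
    using inv_closed x by simp
  show "x \<in> unit_group e"
    using x y l_one r_one l_inv r_inv
    by (intro unit_groupI[where y = "inv\<^bsub>restricted G e\<^esub> x"]) auto
qed

text \<open>A larger group could a priori have another identity \<open>f\<close>; but it contains
  the idempotent \<open>e\<close>, and the only idempotent of a group is its identity.\<close>

lemma maximal_subgroup_unit_group:
  fixes e :: "'a::semigroup_mult"
  assumes e: "e * e = e"
  shows "maximal_subgroup (unit_group e) e"
  unfolding maximal_subgroup_def
proof (intro conjI allI impI)
  show "group (restricted (unit_group e) e)"
    using e by (rule group_unit_group)
  fix G f assume G: "group (restricted G f)" and sub: "unit_group e \<subseteq> G"
  interpret group "restricted G f" by fact
  have "e \<in> G"
    using sub e by (auto intro: unit_groupI)
  then have "e = f"
    using l_cancel_one e by simp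
  then show "G = unit_group e"
    using G sub group_subset_unit_group by blast
qed

lemma inv_unit_group:
  assumes "e * e = e" "e * x = x" "x * e = x" "e * y = y" "y * e = y" "x * y = e" "y * x = e"
  shows "inv\<^bsub>restricted (unit_group e) e\<^esub> x = y"
proof (rule group.inv_equality)
  show "group (restricted (unit_group e) e)"
    using assms by (simp add: group_unit_group)
qed (use assms in \<open>auto intro: unit_groupI\<close>)

section \<open>The maps between Brandt extensions\<close>

lemma trivial_map_zero_iff:
  "trivial_map f \<longleftrightarrow> (\<forall>x. f x = f 0)"
  unfolding trivial_map_def by metis

text \<open>One formula covers both cases of the definition: if \<open>h s = 0\<close>, the entry on
  the right is 0 and so is the triple.\<close>

lemma brandt_map_triple:
  assumes "h 0 = 0"
  shows "brandt_map h \<phi> e H u (triple \<alpha> s \<beta>) =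
    triple (\<phi> \<alpha>) (u \<alpha> * h s * inv\<^bsub>restricted H e\<^esub> (u \<beta>)) (\<phi> \<beta>)"
proof (cases "h s = 0")
  case True
  then have "u \<alpha> * h s * inv\<^bsub>restricted H e\<^esub> (u \<beta>) = 0"
    by simp
  then show ?thesis
    using brandt_map_simps(2)[of h s, OF assms True] by (metis triple_eq_zero_iff)
next
  case False
  then show ?thesis
    using assms by (rule brandt_map_simps(1)[rotated])
qed

lemma semigroup_ideal_kernel:
  assumes "semigroup_hom h" "h 0 = 0"
  shows "semigroup_ideal {s. h s = (0::'t::{semigroup_mult, mult_zero})}"
  using assms unfolding semigroup_ideal_def semigroup_hom_def by auto

lemma semigroup_hom_brandtI:
  assumes zero: "\<sigma> 0 = 0"
    and triple: "\<And>\<alpha> s \<beta> \<gamma> t \<delta>.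
      \<sigma> (triple \<alpha> s \<beta> * triple \<gamma> t \<delta>) = \<sigma> (triple \<alpha> s \<beta>) * \<sigma> (triple \<gamma> t \<delta>)"
  shows "semigroup_hom (\<sigma> :: ('i, 's::{monoid_mult, mult_zero}) brandt \<Rightarrow>
    'b::{semigroup_mult, mult_zero})"
  unfolding semigroup_hom_def
proof (intro allI)
  fix x y :: "('i, 's) brandt"
  show "\<sigma> (x * y) = \<sigma> x * \<sigma> y"
    by (cases x rule: brandt_cases; cases y rule: brandt_cases) (simp_all add: zero triple)
qed

text \<open>In a product of two images the inner factors \<open>inv (u \<beta>) * u \<beta>\<close>
  collapse to \<open>e\<close>, which commutes past \<open>h s\<close> and is absorbed by
  \<open>u \<alpha>\<close>. Injectivity of \<open>\<phi>\<close> makes products with distinct inner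
  indices vanish on both sides.\<close>

lemma brandt_map_hom:
  assumes "map_data h \<phi> e H u" and comm: "\<And>s. e * h s = h s * e"
  shows "semigroup_hom (brandt_map h \<phi> e H u)"
proof -
  have hom: "h (s * t) = h s * h t" and h0: "h 0 = 0" and \<phi>: "inj \<phi>"
    and u: "u \<alpha> \<in> H" and grp: "group (restricted H e)" for s t \<alpha>
    using assms by (auto simp: map_data_def semigroup_hom_def maximal_subgroup_def)
  interpret group "restricted H e" by fact
  have "(u \<alpha> * h s * inv\<^bsub>restricted H e\<^esub> (u \<beta>)) * (u \<beta> * h t * inv\<^bsub>restricted H e\<^esub> (u \<delta>)) =
      u \<alpha> * h (s * t) * inv\<^bsub>restricted H e\<^esub> (u \<delta>)" for \<alpha> \<beta> \<delta> s t
  proof -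
    let ?v = "\<lambda>\<beta>. inv\<^bsub>restricted H e\<^esub> (u \<beta>)"
    have inv: "?v \<beta> * u \<beta> = e" and one: "u \<alpha> * e = u \<alpha>"
      using l_inv r_one u by auto
    have "(u \<alpha> * h s * ?v \<beta>) * (u \<beta> * h t * ?v \<delta>) =
        u \<alpha> * (h s * (?v \<beta> * u \<beta>)) * h t * ?v \<delta>"
      by (simp only: mult.assoc)
    also have "\<dots> = u \<alpha> * e * (h s * h t) * ?v \<delta>"
      unfolding inv comm[symmetric] by (simp only: mult.assoc)
    finally show ?thesis
      by (simp only: one hom)
  qed
  then show ?thesis
    using h0 \<phi> by (intro semigroup_hom_brandtI)
      (auto simp: triple_mult brandt_map_triple brandt_map_simps(3) inj_eq)
qed

text \<open>Undoing the conjugation by \<open>u \<alpha>\<close> turns a zero image of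
  \<open>(\<alpha>, 1, \<alpha>)\<close> into \<open>e * h 1 * e = 0\<close>, and this product
  equals \<open>e * h 1\<close>.\<close>

lemma brandt_map_nontrivial:
  assumes "map_data h \<phi> e H u" and comm: "\<And>s. e * h s = h s * e" and ne: "e * h 1 \<noteq> 0"
  shows "\<not> trivial_map (brandt_map h \<phi> e H u)"
proof
  assume triv: "trivial_map (brandt_map h \<phi> e H u)"
  have h0: "h 0 = 0" and ee: "e * e = e"
    and u: "u \<alpha> \<in> H" and grp: "group (restricted H e)" for \<alpha>
    using assms by (auto simp: map_data_def maximal_subgroup_def)
  interpret group "restricted H e" by fact
  fix \<alpha>
  let ?v = "inv\<^bsub>restricted H e\<^esub> (u \<alpha>)"
  have "brandt_map h \<phi> e H u (triple \<alpha> 1 \<alpha>) = 0"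
    using triv brandt_map_simps(3)[of h \<phi> e H u, OF h0] by (simp add: trivial_map_zero_iff)
  then have "u \<alpha> * h 1 * ?v = 0"
    by (simp add: brandt_map_triple h0 triple_eq_zero_iff)
  then have "?v * (u \<alpha> * h 1 * ?v) * u \<alpha> = 0"
    by simp
  moreover have "?v * u \<alpha> = e"
    using l_inv u by auto
  ultimately have "e * h 1 * e = 0"
    by (metis mult.assoc)
  then show False
    using ne by (metis comm ee mult.assoc)
qed

section \<open>Homomorphisms defined on matrix units and on Brandt extensions\<close>

lemma matrix_units_hom_inj:
  fixes f :: "'i matrix_units \<Rightarrow> 'a::semigroup_mult"
  assumes hom: "semigroup_hom f" and nontriv: "\<not> trivial_map f"
  shows "inj f"
proof (rule injI, rule ccontr)
  have mult: "f (x * y) = f x * f y" for x y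
    using hom by (simp add: semigroup_hom_def)
  have unit: "\<exists>\<alpha> \<beta>. x = triple \<alpha> 1 \<beta>" if "x \<noteq> 0" for x :: "'i matrix_units"
    using that by (metis bit.exhaust brandt_cases)
  have *: "x = y" if eq: "f x = f y" and x: "x \<noteq> 0" for x y
  proof (rule ccontr)
    assume neq: "x \<noteq> y"
    obtain \<alpha> \<beta> where x: "x = triple \<alpha> 1 \<beta>"
      using unit x by blast
    \<comment> \<open>Matrix units are congruence-free: a two-sided product that carries
      \<open>x\<close> to a prescribed unit annihilates \<open>y\<close>, which is 0 or differs from
      \<open>x\<close> in an index.\<close>
    have "f (triple \<gamma> 1 \<delta>) = f 0" for \<gamma> \<delta>
    proof -
      have "triple \<gamma> 1 \<delta> = triple \<gamma> 1 \<alpha> * x * triple \<beta> 1 \<delta>"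
        by (simp add: x triple_mult)
      moreover have "triple \<gamma> 1 \<alpha> * y * triple \<beta> 1 \<delta> = 0"
        using neq unit[of y] by (cases "y = 0") (auto simp: x triple_mult)
      ultimately show ?thesis
        by (metis mult eq)
    qed
    then show False
      using nontriv unit by (metis trivial_map_zero_iff)
  qed
  fix x y assume "f x = f y" "x \<noteq> y"
  then show False
    using * by metis
qed

lemma triple_idemD:
  assumes "triple \<alpha> s \<beta> * triple \<alpha> s \<beta> = triple \<alpha> s \<beta>" "s \<noteq> 0"
  shows "\<alpha> = \<beta>" "s * s = s"
proof -
  show "\<alpha> = \<beta>"
    using assms by (metis triple_mult triple_eq_zero_iff)
  then show "s * s = s"
    using assms by (auto simp: triple_mult triple_eq_iff)
qed

lemma triple_corner:
  fixes x :: "('i, 's::{monoid_mult, mult_zero}) brandt"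
  shows "\<exists>t. triple \<alpha> r \<beta> * x * triple \<gamma> s \<delta> = triple \<alpha> t \<delta>"
proof -
  \<comment> \<open>A vanishing product also has the required form, with entry 0.\<close>
  have "\<exists>t. (0 :: ('i, 's) brandt) = triple \<alpha> t \<delta>"
    by (metis triple_eq_zero_iff)
  then show ?thesis
    by (cases x rule: brandt_cases) (auto simp: triple_mult)
qed

lemma brandt_hom_zero:
  fixes \<sigma> :: "('i, 's::{monoid_mult, mult_zero}) brandt \<Rightarrow>
    ('j, 't::{monoid_mult, mult_zero}) brandt"
  assumes hom: "semigroup_hom \<sigma>" and nontriv: "\<not> trivial_map \<sigma>"
    and no_units: "\<nexists>f :: 'i matrix_units \<Rightarrow> 't. inj f \<and> semigroup_hom f"
  shows "\<sigma> 0 = 0"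
proof (rule ccontr)
  assume nz: "\<sigma> 0 \<noteq> 0"
  have mult: "\<sigma> (x * y) = \<sigma> x * \<sigma> y" for x y
    using hom by (simp add: semigroup_hom_def)
  obtain a e b where 0: "\<sigma> 0 = triple a e b" and e: "e \<noteq> 0"
    using nz by (metis brandt_cases)
  have "b = a"
    using triple_idemD(1)[of a e b] mult[of 0 0] 0 e by simp
  with 0 have 0: "\<sigma> 0 = triple a e a"
    by simp
  \<comment> \<open>The non-zero element \<open>\<sigma> 0\<close> absorbs \<open>\<sigma> x\<close>
    from both sides, so \<open>\<sigma> x\<close> is non-zero and both its indices are
    \<open>a\<close>.\<close>
  have "\<exists>t. \<sigma> x = triple a t a" for x
  proof -
    have "\<sigma> x * triple a e a = triple a e a" "triple a e a * \<sigma> x = triple a e a"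
      using mult[of x 0] mult[of 0 x] 0 by simp_all
    then show ?thesis
      using e by (metis brandt_cases mult_zero_left triple_mult triple_eq_zero_iff)
  qed
  then obtain t where t: "\<And>x. \<sigma> x = triple a (t x) a"
    by metis
  have t_mult: "t (x * y) = t x * t y" for x y
  proof -
    have "triple a (t (x * y)) a = triple a (t x * t y) a"
      using mult[of x y] by (simp add: t triple_mult)
    then show ?thesis
      by (auto simp: triple_eq_iff)
  qed
  have t_eq: "t x = t y \<longleftrightarrow> \<sigma> x = \<sigma> y" for x y
    by (auto simp: t triple_eq_iff)
  have factor: "triple \<alpha> s \<beta> = triple \<alpha> 1 \<alpha> * triple \<alpha> s \<beta>" for \<alpha> \<beta> and s :: 's
    by (simp add: triple_mult)
  \<comment> \<open>If every diagonal unit were sent to \<open>\<sigma> 0\<close>, each triple would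
    be too, since it has a diagonal unit as a left identity.\<close>
  obtain \<alpha> where \<alpha>: "\<sigma> (triple \<alpha> 1 \<alpha>) \<noteq> \<sigma> 0"
  proof (rule ccontr)
    assume "\<not> thesis"
    then have "\<sigma> (triple \<alpha> 1 \<alpha>) = \<sigma> 0" for \<alpha>
      using that by blast
    then have "\<sigma> (triple \<alpha> s \<beta>) = \<sigma> 0" for \<alpha> s \<beta>
      using mult[of 0 "triple \<alpha> s \<beta>"] by (metis factor mult mult_zero_left)
    then have "\<sigma> x = \<sigma> 0" for x
      by (metis brandt_cases)
    then show False
      using nontriv by (auto simp: trivial_map_zero_iff)
  qed
  then have one: "(1 :: 's) \<noteq> 0"
    by (metis triple_eq_zero_iff)
  \<comment> \<open>\<open>?g\<close> is the canonical copy of the matrix units inside the Brandt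
    extension of \<open>S\<close>. It is itself a \<open>brandt_map\<close>, so the direct half of
    the theorem shows that it is a homomorphism.\<close>
  let ?h = "\<lambda>b :: bit. if b = 0 then 0 else (1 :: 's)"
  let ?g = "brandt_map ?h (id :: 'i \<Rightarrow> 'i) 1 (unit_group 1) (\<lambda>_. 1)"
  have "map_data ?h (id :: 'i \<Rightarrow> 'i) 1 (unit_group 1) (\<lambda>_. 1)"
    using one by (auto simp: map_data_def semigroup_hom_def maximal_subgroup_unit_group
        intro: unit_groupI)
  then have g: "semigroup_hom ?g"
    by (rule brandt_map_hom) simp
  have "inv\<^bsub>restricted (unit_group 1) 1\<^esub> 1 = (1 :: 's)"
    by (rule inv_unit_group) simp_all
  then have g_unit: "?g (triple \<alpha> 1 \<alpha>) = triple \<alpha> 1 \<alpha>" and g_zero: "?g 0 = 0"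
    by (simp_all add: brandt_map_triple brandt_map_simps(3))
  have "semigroup_hom (t \<circ> ?g)"
    using g by (simp add: semigroup_hom_def t_mult)
  moreover have "\<not> trivial_map (t \<circ> ?g)"
  proof
    assume "trivial_map (t \<circ> ?g)"
    then have "t (?g (triple \<alpha> 1 \<alpha>)) = t (?g 0)"
      by (auto simp: trivial_map_def)
    then show False
      using \<alpha> by (simp only: g_unit g_zero t_eq)
  qed
  ultimately show False
    using no_units matrix_units_hom_inj by blast
qed

lemma brandt_hom_is_brandt_map:
  fixes \<sigma> :: "('i, 's::{monoid_mult, mult_zero}) brandt \<Rightarrow>
    ('j, 't::{monoid_mult, mult_zero}) brandt"
  assumes hom: "semigroup_hom \<sigma>" and nontriv: "\<not> trivial_map \<sigma>" and zero: "\<sigma> 0 = 0"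
    and central: "\<And>f x :: 't. f * f = f \<Longrightarrow> f * x = x * f"
  shows "\<exists>h \<phi> e H u. map_data h \<phi> e H u \<and> (\<forall>s. e * h s = h s * e) \<and> e * h 1 \<noteq> 0 \<and>
    \<sigma> = brandt_map h \<phi> e H u"
proof -
  have mult: "\<sigma> (x * y) = \<sigma> x * \<sigma> y" for x y
    using hom by (simp add: semigroup_hom_def)
  \<comment> \<open>Each diagonal unit generates the whole Brandt extension as an ideal, so killing
    one kills everything.\<close>
  have diag_nz: "\<sigma> (triple \<alpha> 1 \<alpha>) \<noteq> 0" for \<alpha>
  proof
    assume \<alpha>: "\<sigma> (triple \<alpha> 1 \<alpha>) = 0"
    have "\<sigma> (triple \<beta> s \<gamma>) = 0" for \<beta> s \<gamma>
    proof -
      have "triple \<beta> s \<gamma> = triple \<beta> 1 \<alpha> * triple \<alpha> 1 \<alpha> * triple \<alpha> s \<gamma>"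
        by (simp add: triple_mult)
      then show ?thesis
        by (simp only: mult \<alpha> mult_zero_left mult_zero_right)
    qed
    then have "\<sigma> x = \<sigma> 0" for x
      by (metis brandt_cases zero)
    then show False
      using nontriv by (simp add: trivial_map_zero_iff)
  qed
  have "\<exists>a f. \<sigma> (triple \<alpha> 1 \<alpha>) = triple a f a \<and> f \<noteq> 0 \<and> f * f = f" for \<alpha>
  proof -
    obtain a f b where *: "\<sigma> (triple \<alpha> 1 \<alpha>) = triple a f b" "f \<noteq> 0"
      using diag_nz by (metis brandt_cases)
    have idem: "triple a f b * triple a f b = triple a f b"
      by (simp add: triple_mult flip: *(1) mult)
    then show ?thesis
      using triple_idemD[OF idem *(2)] * by auto
  qed
  then obtain \<phi> \<epsilon> where diag: "\<And>\<alpha>. \<sigma> (triple \<alpha> 1 \<alpha>) = triple (\<phi> \<alpha>) (\<epsilon> \<alpha>) (\<phi> \<alpha>)"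
    and \<epsilon>_nz: "\<And>\<alpha>. \<epsilon> \<alpha> \<noteq> 0" and \<epsilon>_idem: "\<And>\<alpha>. \<epsilon> \<alpha> * \<epsilon> \<alpha> = \<epsilon> \<alpha>"
    by metis
  have "\<exists>t. \<sigma> (triple \<alpha> s \<beta>) = triple (\<phi> \<alpha>) t (\<phi> \<beta>)" for \<alpha> s \<beta>
  proof -
    have "\<sigma> (triple \<alpha> s \<beta>) = triple (\<phi> \<alpha>) (\<epsilon> \<alpha>) (\<phi> \<alpha>) * \<sigma> (triple \<alpha> s \<beta>) *
        triple (\<phi> \<beta>) (\<epsilon> \<beta>) (\<phi> \<beta>)"
      by (simp add: triple_mult flip: mult diag)
    then show ?thesis
      by (metis triple_corner)
  qed
  then obtain k where k: "\<And>\<alpha> s \<beta>. \<sigma> (triple \<alpha> s \<beta>) = triple (\<phi> \<alpha>) (k \<alpha> s \<beta>) (\<phi> \<beta>)"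
    by metis
  \<comment> \<open>Triples with the same outer indices have equal entries if they are equal, also
    when both are zero.\<close>
  have k_mult: "k \<alpha> s \<beta> * k \<beta> t \<gamma> = k \<alpha> (s * t) \<gamma>" for \<alpha> \<beta> \<gamma> s t
    using mult[of "triple \<alpha> s \<beta>" "triple \<beta> t \<gamma>"] by (auto simp: triple_mult k triple_eq_iff)
  have k_zero: "k \<alpha> 0 \<beta> = 0" for \<alpha> \<beta>
    using k[of \<alpha> 0 \<beta>] zero by (metis triple_eq_zero_iff)
  have k_diag: "k \<alpha> 1 \<alpha> = \<epsilon> \<alpha>" for \<alpha>
    using k[of \<alpha> 1 \<alpha>] \<epsilon>_nz by (auto simp: diag triple_eq_iff)
  \<comment> \<open>This is \<open>\<epsilon> \<alpha> \<le> \<epsilon> \<beta>\<close> in the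
    natural order of idempotents: insert \<open>\<epsilon> \<beta>\<close> into a factorization of
    \<open>\<epsilon> \<alpha>\<close> through \<open>\<beta>\<close> and move it out by centrality.
    Symmetry then gives equality.\<close>
  have \<epsilon>_le: "\<epsilon> \<alpha> = \<epsilon> \<alpha> * \<epsilon> \<beta>" for \<alpha> \<beta>
  proof -
    have "\<epsilon> \<alpha> = k \<alpha> 1 \<beta> * \<epsilon> \<beta> * k \<beta> 1 \<alpha>"
      by (simp add: k_mult flip: k_diag)
    also have "\<dots> = k \<alpha> 1 \<beta> * k \<beta> 1 \<alpha> * \<epsilon> \<beta>"
      by (metis central \<epsilon>_idem mult.assoc)
    also have "\<dots> = \<epsilon> \<alpha> * \<epsilon> \<beta>"
      by (simp add: k_mult k_diag)
    finally show ?thesis .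
  qed
  have \<epsilon>_eq: "\<epsilon> \<alpha> = \<epsilon> \<beta>" for \<alpha> \<beta>
    using \<epsilon>_le central \<epsilon>_idem by metis
  fix \<iota> :: 'i
  define e where "e = \<epsilon> \<iota>"
  have k_unit: "k \<alpha> 1 \<alpha> = e" for \<alpha>
    by (simp add: k_diag e_def \<epsilon>_eq[of \<alpha> \<iota>])
  have e_idem: "e * e = e" and e_nz: "e \<noteq> 0"
    by (simp_all add: e_def \<epsilon>_idem \<epsilon>_nz)
  have k_e: "e * k \<alpha> s \<beta> = k \<alpha> s \<beta>" "k \<alpha> s \<beta> * e = k \<alpha> s \<beta>" for \<alpha> s \<beta>
    using k_mult[of \<alpha> 1 \<alpha> s \<beta>] k_mult[of \<alpha> s \<beta> 1 \<beta>] by (simp_all add: k_unit)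
  let ?h = "\<lambda>s. k \<iota> s \<iota>" and ?u = "\<lambda>\<alpha>. k \<alpha> 1 \<iota>"
  \<comment> \<open>Distinct diagonal units multiply to 0; if their images shared an index, the
    product of these would be the non-zero triple with entry \<open>e\<close>.\<close>
  have "inj \<phi>"
  proof (rule injI, rule ccontr)
    fix \<alpha> \<beta> assume "\<phi> \<alpha> = \<phi> \<beta>" "\<alpha> \<noteq> \<beta>"
    then have "triple (\<phi> \<alpha>) (e * e) (\<phi> \<alpha>) = 0"
      using mult[of "triple \<alpha> 1 \<alpha>" "triple \<beta> 1 \<beta>"] by (simp add: triple_mult k k_unit zero)
    then show False
      using e_idem e_nz by (simp add: triple_eq_zero_iff)
  qed
  \<comment> \<open>The entries of the mutually inverse units \<open>(\<alpha>, 1, \<iota>)\<close>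
    and \<open>(\<iota>, 1, \<alpha>)\<close> are mutually inverse in
    \<open>unit_group e\<close>.\<close>
  moreover have "?u \<alpha> \<in> unit_group e" for \<alpha>
    by (rule unit_groupI[where y = "k \<iota> 1 \<alpha>"]) (simp_all add: k_e k_mult k_unit)
  ultimately have data: "map_data ?h \<phi> e (unit_group e) ?u"
    using e_idem e_nz
    by (simp add: map_data_def semigroup_hom_def k_mult k_zero maximal_subgroup_unit_group)
  have inv_u: "inv\<^bsub>restricted (unit_group e) e\<^esub> (?u \<alpha>) = k \<iota> 1 \<alpha>" for \<alpha>
    by (rule inv_unit_group) (simp_all add: e_idem k_e k_mult k_unit)
  \<comment> \<open>On triples this is the factorization of \<open>(\<alpha>, s, \<beta>)\<close> as
    \<open>(\<alpha>, 1, \<iota>) * (\<iota>, s, \<iota>) * (\<iota>, 1, \<beta>)\<close>, read off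
    in the entries.\<close>
  have "\<sigma> x = brandt_map ?h \<phi> e (unit_group e) ?u x" for x
    by (cases x rule: brandt_cases)
      (simp_all add: zero brandt_map_simps(3) brandt_map_triple k_zero inv_u k_mult k)
  then have "\<sigma> = brandt_map ?h \<phi> e (unit_group e) ?u"
    by blast
  moreover have "\<forall>s. e * ?h s = ?h s * e" "e * ?h 1 \<noteq> 0"
    by (simp_all add: k_e k_unit e_idem e_nz)
  ultimately show ?thesis
    using data by blast
qed

theorem theorem3p10:
  assumes "(UNIV :: 'i set) \<lesssim> (UNIV :: 'j set)"
  shows
    "(\<forall>(h :: 's::{monoid_mult, mult_zero} \<Rightarrow> 't::{monoid_mult, mult_zero})
        (\<phi> :: 'i \<Rightarrow> 'j) e H u.
        map_data h \<phi> e H u \<longrightarrow>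
          semigroup_ideal {s. h s = 0} \<and>
          ((\<forall>s. e * h s = h s * e) \<and> e * h 1 \<noteq> 0 \<longrightarrow>
            semigroup_hom (brandt_map h \<phi> e H u) \<and>
            \<not> trivial_map (brandt_map h \<phi> e H u))) \<and>
     ((\<forall>f :: 't. f * f = f \<longrightarrow> (\<forall>x. f * x = x * f)) \<and> B_star TYPE('i) TYPE('t) \<longrightarrow>
        (\<forall>\<sigma> :: ('i, 's) brandt \<Rightarrow> ('j, 't) brandt.
          semigroup_hom \<sigma> \<and> \<not> trivial_map \<sigma> \<longrightarrow>
            (\<exists>h \<phi> e H u. map_data h \<phi> e H u \<and>
              (\<forall>s. e * h s = h s * e) \<and> e * h 1 \<noteq> 0 \<and>
              \<sigma> = brandt_map h \<phi> e H u)))"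
proof (intro conjI allI impI)
  fix h :: "'s \<Rightarrow> 't" and \<phi> :: "'i \<Rightarrow> 'j" and e H u
  assume data: "map_data h \<phi> e H u"
  then show "semigroup_ideal {s. h s = 0}"
    by (simp add: map_data_def semigroup_ideal_kernel)
  assume e: "(\<forall>s. e * h s = h s * e) \<and> e * h 1 \<noteq> 0"
  show "semigroup_hom (brandt_map h \<phi> e H u)"
    using data e brandt_map_hom by blast
  show "\<not> trivial_map (brandt_map h \<phi> e H u)"
    using data e brandt_map_nontrivial by blast
next
  fix \<sigma> :: "('i, 's) brandt \<Rightarrow> ('j, 't) brandt"
  assume T: "(\<forall>f :: 't. f * f = f \<longrightarrow> (\<forall>x. f * x = x * f)) \<and> B_star TYPE('i) TYPE('t)"
    and \<sigma>: "semigroup_hom \<sigma> \<and> \<not> trivial_map \<sigma>"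
  have "\<sigma> 0 = 0"
    using brandt_hom_zero[of \<sigma>] T \<sigma> unfolding B_star_def by blast
  then show "\<exists>h \<phi> e H u. map_data h \<phi> e H u \<and> (\<forall>s. e * h s = h s * e) \<and> e * h 1 \<noteq> 0 \<and>
      \<sigma> = brandt_map h \<phi> e H u"
    using brandt_hom_is_brandt_map[of \<sigma>] T \<sigma> by blast
qed

end
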